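(* Let $\lambda_0,\lambda_1\in\sigma(\mathcal A)$, let $x\in\ker\Delta(\lambda_0)$, $y\in\ker\Delta^*(\bar\lambda_1)$, and let $\varphi=((I-e^{-\lambda_0}A_{-1})x,\ e^{\lambda_0\theta}x)$ and $\psi=\big(y,\ [\bar\lambda_1e^{-\bar\lambda_1\theta}-A_2^*(\theta)+e^{-\bar\lambda_1\theta}\int_0^\theta e^{\bar\lambda_1 s}(A_3^*(s)+\bar\lambda_1A_2^*(s))\,ds]\,y\big)$ (so $(\mathcal A-\lambda_0I)\varphi=0$ and $(\mathcal A^*-\bar\lambda_1I)\psi=0$). Then $\langle\varphi,\psi\rangle_{M_2}=0$ if $\lambda_0\neq\lambda_1$, and $\langle\varphi,\psi\rangle_{M_2}=-\langle\Delta'(\lambda_0)x,y\rangle_{\mathbb C^n}$ if $\lambda_0=\lambda_1$, where $\Delta'=\frac{d}{d\lambda}\Delta$.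
   Context: Setting: $n\ge1$, $A_{-1}\in\mathbb C^{n\times n}$, $A_2,A_3\in L_2([-1,0];\mathbb C^{n\times n})$; $M_2=\mathbb C^n\times L_2(-1,0;\mathbb C^n)$ with inner product $\langle(y_1,z_1),(y_2,z_2)\rangle=\langle y_1,y_2\rangle_{\mathbb C^n}+\int_{-1}^0\langle z_1(\theta),z_2(\theta)\rangle d\theta$; $\mathcal A(y,z)=\big(\int_{-1}^0A_2(\theta)z'(\theta)d\theta+\int_{-1}^0A_3(\theta)z(\theta)d\theta,\ z'\big)$ with domain $\{(y,z): z\in H^1(-1,0;\mathbb C^n),\ y=z(0)-A_{-1}z(-1)\}$. $\Delta(\lambda)=-\lambda I+\lambda e^{-\lambda}A_{-1}+\lambda\int_{-1}^0e^{\lambda s}A_2(s)ds+\int_{-1}^0e^{\lambda s}A_3(s)ds$, $\Delta^*(\lambda)$ the same with $A_{-1},A_2,A_3$ replaced by conjugate transposes, so $\Delta(\lambda)^*=\Delta^*(\bar\lambda)$; $\sigma(\mathcal A)$ is the set of roots of $\det\Delta$. *)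

theory Defs
  imports "HOL-Analysis.Analysis"
begin

text \<open>n x n complex matrices are represented as complex^'n^'n for a finite index type 'n
(so n = CARD('n) \<ge> 1). Functions on [-1,0] are total functions real \<Rightarrow> _ considered on {-1..0}.\<close>

definition msc :: "complex \<Rightarrow> complex^'n^'m \<Rightarrow> complex^'n^'m" where
  "msc c A = (\<chi> i j. c * A $ i $ j)"

definition cadj :: "complex^'n^'n \<Rightarrow> complex^'n^'n" where
  "cadj A = (\<chi> i j. cnj (A $ j $ i))"

definition cip :: "complex^'n \<Rightarrow> complex^'n \<Rightarrow> complex" where
  "cip u v = (\<Sum>i\<in>UNIV. u $ i * cnj (v $ i))"

definition L2mat :: "(real \<Rightarrow> complex^'n^'n) \<Rightarrow> bool" where
  "L2mat A \<longleftrightarrow> set_borel_measurable lborel {-1..0} A \<and>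
     set_integrable lborel {-1..0} (\<lambda>s. (norm (A s))^2)"

definition Delta :: "complex^'n^'n \<Rightarrow> (real \<Rightarrow> complex^'n^'n) \<Rightarrow> (real \<Rightarrow> complex^'n^'n)
    \<Rightarrow> complex \<Rightarrow> complex^'n^'n" where
  "Delta Am1 A2 A3 l =
     msc (-l) (mat 1) + msc (l * exp (-l)) Am1
     + msc l (LINT s:{-1..0}|lborel. msc (exp (l * of_real s)) (A2 s))
     + (LINT s:{-1..0}|lborel. msc (exp (l * of_real s)) (A3 s))"

definition Delta_star :: "complex^'n^'n \<Rightarrow> (real \<Rightarrow> complex^'n^'n) \<Rightarrow> (real \<Rightarrow> complex^'n^'n)
    \<Rightarrow> complex \<Rightarrow> complex^'n^'n" where
  "Delta_star Am1 A2 A3 = Delta (cadj Am1) (\<lambda>s. cadj (A2 s)) (\<lambda>s. cadj (A3 s))"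

definition Delta_deriv :: "complex^'n^'n \<Rightarrow> (real \<Rightarrow> complex^'n^'n) \<Rightarrow> (real \<Rightarrow> complex^'n^'n)
    \<Rightarrow> complex \<Rightarrow> complex^'n^'n" where
  "Delta_deriv Am1 A2 A3 l = (\<chi> i j. deriv (\<lambda>z. Delta Am1 A2 A3 z $ i $ j) l)"

definition M2_inner :: "(complex^'n) \<times> (real \<Rightarrow> complex^'n) \<Rightarrow> (complex^'n) \<times> (real \<Rightarrow> complex^'n) \<Rightarrow> complex" where
  "M2_inner p q = cip (fst p) (fst q) + (LINT t:{-1..0}|lborel. cip (snd p t) (snd q t))"

end

theory Submission
  imports Defs
begin

(* Fix x, y and write delta(l) = <Delta(l) x, y>.  The heart of the proof is an identity that holds
   for ALL x, y (no kernel conditions):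
     (l0 - l1) <phi, psi> = exp (l1 - l0) delta(l1) - delta(l0)      if l0 ~= l1,
     <phi, psi> = - delta(l) - delta'(l)                           if l0 = l1 = l.
   The theorem follows at once: x in ker Delta(l0) gives delta(l0) = 0, and y in ker Delta*(conj l1)
   gives delta(l1) = 0 because Delta*(conj l) is the conjugate transpose of Delta(l).

   The development first reduces everything to scalars: complex-linear functionals (entries, and
   pairings M |-> <M x, y>) commute with the weighted matrix integrals in Delta, so all quantities
   become exponential transforms  T a (l) = int_{-1}^0 exp(l s) a(s) ds  of the integrable functions
   a_k(s) = <A_k(s) x, y>, and T a is differentiable with derivative T (s a).  The pairing <phi, psi>
   involves a double integral over the triangle -1 <= t <= s <= 0, which Fubini turns into a single
   integral against int_{-1}^s exp((l0 - l1) t) dt; evaluating that elementary integral in the two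
   cases l0 ~= l1 and l0 = l1 yields the two identities above by algebra.  The hypotheses
   det Delta(l0) = det Delta(l1) = 0 only say that the kernels are nontrivial; the computation
   does not need them. *)

lemma cip_add_left: "cip (u + v) w = cip u w + cip v w"
  by (simp add: cip_def sum.distrib algebra_simps)

lemma cip_diff_left: "cip (u - v) w = cip u w - cip v w"
  by (simp add: cip_def sum_subtractf algebra_simps)

lemma cip_scale_left: "cip (c *s u) w = c * cip u w"
  by (simp add: cip_def sum_distrib_left algebra_simps)

lemma cip_add_right: "cip u (v + w) = cip u v + cip u w"
  by (simp add: cip_def sum.distrib algebra_simps)

lemma cip_diff_right: "cip u (v - w) = cip u v - cip u w"
  by (simp add: cip_def sum_subtractf algebra_simps)

lemma cip_scale_right: "cip u (c *s w) = cnj c * cip u w"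
  by (simp add: cip_def sum_distrib_left algebra_simps)

lemma cip_commute: "cip u v = cnj (cip v u)"
  by (simp add: cip_def cnj_sum mult.commute)

lemma neg_mult_vec: "(- M) *v v = - (M *v (v::complex^'n))"
  by (simp add: matrix_vector_mult_def vec_eq_iff sum_negf[symmetric])

lemma msc_mult_vec: "msc c M *v v = c *s (M *v v)"
  by (simp add: msc_def matrix_vector_mult_def vec_eq_iff sum_distrib_left algebra_simps)

lemma cip_cadj: "cip u (cadj M *v v) = cip (M *v u) v"
  unfolding cip_def cadj_def matrix_vector_mult_def
  by (simp add: cnj_sum sum_distrib_left sum_distrib_right, subst sum.swap, simp add: mult_ac)

lemma cadj_msc: "cadj (msc c M) = msc (cnj c) (cadj M)"
  by (simp add: cadj_def msc_def vec_eq_iff)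

lemma cadj_add: "cadj (M + N) = cadj M + cadj N"
  by (simp add: cadj_def vec_eq_iff)

lemma cadj_mat1: "cadj (mat 1) = mat 1"
  by (simp add: cadj_def vec_eq_iff mat_def)

lemma bounded_linear_cadj: "bounded_linear (cadj :: complex^'n^'n \<Rightarrow> _)"
proof -
  have "linear (cadj :: complex^'n^'n \<Rightarrow> _)"
    by (rule linearI) (simp_all add: cadj_def vec_eq_iff complex_cnj_scaleR)
  then show ?thesis by (simp add: linear_conv_bounded_linear)
qed

lemma norm_msc: "norm (msc c (M::complex^'n^'m)) = cmod c * norm M"
proof -
  have row: "norm (msc c M $ i) = cmod c * norm (M $ i)" for i
    by (simp add: msc_def norm_vec_def L2_set_right_distrib norm_mult)
  show ?thesis
    unfolding norm_vec_def[of "msc c M"] norm_vec_def[of M] row by (simp add: L2_set_right_distrib)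
qed

definition mat_functional :: "(complex^'n^'m \<Rightarrow> complex) \<Rightarrow> bool" where
  "mat_functional L \<longleftrightarrow> (\<forall>M N. L (M + N) = L M + L N) \<and> (\<forall>c M. L (msc c M) = c * L M)"

lemma mat_functional_bounded_linear:
  assumes "mat_functional L" shows "bounded_linear L"
proof -
  have scale: "r *\<^sub>R M = msc (complex_of_real r) M" for r M
    by (simp add: msc_def vec_eq_iff of_real_def)
  have "L (r *\<^sub>R M) = r *\<^sub>R L M" for r M
    using assms unfolding scale mat_functional_def by (simp add: scaleR_conv_of_real)
  moreover have "L (M + N) = L M + L N" for M N
    using assms by (simp add: mat_functional_def)
  ultimately have "linear L"
    by (intro linearI)
  then show ?thesis
    by (simp add: linear_conv_bounded_linear)
qed

lemma mat_functional_entry: "mat_functional (\<lambda>M. M $ i $ j)"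
  by (simp add: mat_functional_def msc_def)

lemma mat_functional_pairing: "mat_functional (\<lambda>M. cip (M *v x) y)"
  by (simp add: mat_functional_def matrix_vector_mult_add_rdistrib cip_add_left msc_mult_vec
      cip_scale_left)

lemma bounded_linear_pairing_right: "bounded_linear (\<lambda>M::complex^'n^'m. cip x (M *v y))"
proof -
  have "bounded_linear (\<lambda>M::complex^'n^'m. cnj (cip (M *v y) x))"
    by (rule bounded_linear_compose[OF bounded_linear_cnj
          mat_functional_bounded_linear[OF mat_functional_pairing]])
  then show ?thesis
    by (subst cip_commute) simp
qed

text \<open>On a set of finite measure, square integrability implies integrability.\<close>

lemma L2mat_set_integrable:
  assumes "L2mat A" shows "set_integrable lborel {-1..0::real} A"
proof -
  have meas: "(\<lambda>s. indicator {-1..0} s *\<^sub>R A s) \<in> borel_measurable lborel"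
    using assms by (simp add: L2mat_def set_borel_measurable_def)
  have "integrable lborel (\<lambda>s. indicator {-1..0::real} s *\<^sub>R (norm (A s))^2)"
    using assms by (simp add: L2mat_def set_integrable_def)
  moreover have "integrable lborel (\<lambda>s. indicator {-1..0::real} s :: real)"
    by (rule integrable_real_indicator) auto
  ultimately have dom: "integrable lborel
      (\<lambda>s. indicator {-1..0::real} s + indicator {-1..0::real} s *\<^sub>R (norm (A s))^2)"
    by (intro Bochner_Integration.integrable_add)
  have "r \<le> 1 + r^2" for r :: real
  proof -
    have "2 * r \<le> r^2 + 1" using zero_le_power2[of "r - 1"] by (simp add: power2_diff)
    then show ?thesis using zero_le_power2[of r] by linarith
  qed
  then show ?thesis unfolding set_integrable_def
    by (intro Bochner_Integration.integrable_bound[OF dom meas]) (auto simp: indicator_def)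
qed

lemma set_integral_bounded_linear:
  assumes T: "bounded_linear T" and f: "set_integrable M A f"
  shows "set_integrable M A (\<lambda>x. T (f x))"
    and "(LINT x:A|M. T (f x)) = T (LINT x:A|M. f x)"
proof -
  have eq: "(\<lambda>x. indicator A x *\<^sub>R T (f x)) = (\<lambda>x. T (indicator A x *\<^sub>R f x))"
    using linear_scale[OF bounded_linear.linear[OF T]] by simp
  show "set_integrable M A (\<lambda>x. T (f x))"
    using f unfolding set_integrable_def eq by (rule integrable_bounded_linear[OF T])
  show "(LINT x:A|M. T (f x)) = T (LINT x:A|M. f x)"
    using f unfolding set_integrable_def set_lebesgue_integral_def eq
    by (rule integral_bounded_linear[OF T])
qed

lemma set_integrable_pairing:
  assumes "set_integrable lborel S A"
  shows "set_integrable lborel S (\<lambda>s. cip (A s *v x) y)"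
  by (rule set_integral_bounded_linear(1)[OF _ assms])
     (rule mat_functional_bounded_linear[OF mat_functional_pairing])

lemma set_integrable_bounded_factor:
  fixes a :: "real \<Rightarrow> 'a::{banach, second_countable_topology}"
    and h :: "complex \<Rightarrow> 'a \<Rightarrow> 'b::{banach, second_countable_topology}"
  assumes a: "set_integrable lborel S a" and S: "S \<in> sets lborel"
    and g: "g \<in> borel_measurable lborel" and B: "\<And>s. s \<in> S \<Longrightarrow> cmod (g s) \<le> B"
    and h_cont: "continuous_on UNIV (\<lambda>p. h (fst p) (snd p))"
    and h_scaleR: "\<And>c r v. h c (r *\<^sub>R v) = r *\<^sub>R h c v"
    and h_norm: "\<And>c v. norm (h c v) \<le> cmod c * norm v"
  shows "set_integrable lborel S (\<lambda>s. h (g s) (a s))"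
proof (rule set_integrable_bound)
  show "set_integrable lborel S (\<lambda>s. \<bar>B\<bar> * norm (a s))"
    using set_integrable_norm[OF a] by (rule set_integrable_mult_right)
  have "(\<lambda>s. indicator S s *\<^sub>R a s) \<in> borel_measurable lborel"
    using a unfolding set_integrable_def by (rule borel_measurable_integrable)
  then have "(\<lambda>s. h (g s) (indicator S s *\<^sub>R a s)) \<in> borel_measurable lborel"
    by (rule borel_measurable_continuous_Pair[OF g _ h_cont])
  then show "set_borel_measurable lborel S (\<lambda>s. h (g s) (a s))"
    unfolding set_borel_measurable_def by (simp add: h_scaleR)
  show "AE s in lborel. s \<in> S \<longrightarrow> norm (h (g s) (a s)) \<le> norm (\<bar>B\<bar> * norm (a s))"
  proof (intro AE_I2 impI)
    fix s assume "s \<in> S"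
    then have "cmod (g s) * norm (a s) \<le> \<bar>B\<bar> * norm (a s)"
      using B[of s] by (intro mult_right_mono) auto
    then show "norm (h (g s) (a s)) \<le> norm (\<bar>B\<bar> * norm (a s))"
      using h_norm[of "g s" "a s"] by simp
  qed
qed

lemma set_integrable_msc:
  fixes A :: "real \<Rightarrow> complex^'n^'m"
  assumes "set_integrable lborel S A" "S \<in> sets lborel" "g \<in> borel_measurable lborel"
    and "\<And>s. s \<in> S \<Longrightarrow> cmod (g s) \<le> B"
  shows "set_integrable lborel S (\<lambda>s. msc (g s) (A s))"
proof (rule set_integrable_bounded_factor[OF assms])
  show "continuous_on UNIV (\<lambda>p :: complex \<times> (complex^'n^'m). msc (fst p) (snd p))"
    unfolding msc_def by (intro continuous_intros)
  show "msc c (r *\<^sub>R M) = r *\<^sub>R msc c M" for c r and M :: "complex^'n^'m"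
    by (simp add: msc_def vec_eq_iff)
  show "norm (msc c M) \<le> cmod c * norm M" for c and M :: "complex^'n^'m"
    by (simp add: norm_msc)
qed

lemma set_integrable_mult_bounded:
  fixes a :: "real \<Rightarrow> complex"
  assumes "set_integrable lborel S a" "S \<in> sets lborel" "g \<in> borel_measurable lborel"
    and "\<And>s. s \<in> S \<Longrightarrow> cmod (g s) \<le> B"
  shows "set_integrable lborel S (\<lambda>s. g s * a s)"
  by (rule set_integrable_bounded_factor[OF assms])
     (auto intro!: continuous_intros simp: norm_mult)

lemma norm_exp_weight:
  assumes "s \<in> {-1..0::real}"
  shows "cmod (exp (l * of_real s)) \<le> exp (cmod l)"
proof -
  have "cmod (l * of_real s) \<le> cmod l"
    using assms mult_left_mono[of "-s" 1 "cmod l"] by (auto simp: norm_mult)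
  then show ?thesis
    using norm_exp[of "l * of_real s"] by (meson exp_le_cancel_iff order_trans)
qed

lemma integral_msc_bounded_linear:
  fixes A :: "real \<Rightarrow> complex^'n^'m"
  assumes T: "bounded_linear T" and A: "set_integrable lborel S A" and S: "S \<subseteq> {-1..0}"
    and S_meas: "S \<in> sets lborel"
  shows "T (LINT s:S|lborel. msc (exp (l * of_real s)) (A s))
       = (LINT s:S|lborel. T (msc (exp (l * of_real s)) (A s)))"
proof -
  have "set_integrable lborel S (\<lambda>s. msc (exp (l * of_real s)) (A s))"
    by (rule set_integrable_msc[OF A S_meas _, where B = "exp (cmod l)"])
       (use S norm_exp_weight in auto)
  then show ?thesis
    by (rule set_integral_bounded_linear(2)[OF T, symmetric])
qed

section \<open>The exponential transform on \<open>[-1,0]\<close>\<close>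

definition exp_transform :: "(real \<Rightarrow> complex) \<Rightarrow> complex \<Rightarrow> complex" where
  "exp_transform a l = (LINT s:{-1..0}|lborel. exp (l * of_real s) * a s)"

lemma set_integrable_exp_weight:
  fixes a :: "real \<Rightarrow> complex"
  assumes "set_integrable lborel {-1..0} a"
  shows "set_integrable lborel {-1..0} (\<lambda>s. exp (l * of_real s) * a s)"
  by (rule set_integrable_mult_bounded[OF assms _ _ norm_exp_weight]) auto

lemma set_integrable_times_var:
  fixes a :: "real \<Rightarrow> complex"
  assumes "set_integrable lborel {-1..0} a"
  shows "set_integrable lborel {-1..0} (\<lambda>s. of_real s * a s)"
  by (rule set_integrable_mult_bounded[OF assms, where B = 1]) auto

lemma exp_transform_add:
  fixes a b :: "real \<Rightarrow> complex"
  assumes "set_integrable lborel {-1..0} a" "set_integrable lborel {-1..0} b"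
  shows "exp_transform (\<lambda>s. a s + b s) l = exp_transform a l + exp_transform b l"
  unfolding exp_transform_def distrib_left
  by (rule set_integral_add(2)[OF set_integrable_exp_weight set_integrable_exp_weight]) fact+

lemma exp_transform_mult: "exp_transform (\<lambda>s. c * a s) l = c * exp_transform a l"
  unfolding exp_transform_def by (simp add: mult.left_commute)

lemma exp_quad_bound:
  fixes z :: complex
  assumes "norm z \<le> 1 / 2"
  shows "norm (exp z - 1 - z) \<le> norm z ^ 2"
proof (cases "z = 0")
  case False
  have sums: "(\<lambda>k. z ^ (k + 2) /\<^sub>R fact (k + 2)) sums (exp z - (\<Sum>k<2. z ^ k /\<^sub>R fact k))"
    by (intro sums_split_initial_segment exp_converges)
  have "summable (\<lambda>k. norm z ^ (k + 2) /\<^sub>R fact (k + 2))"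
    using summable_norm_exp[of z]
    by (intro summable_norm summable_ignore_initial_segment)
       (auto simp: norm_power norm_divide divide_simps)
  also have "?this \<longleftrightarrow> summable (\<lambda>k. norm z ^ 2 * (norm z ^ k / fact (k +2)))"
    by (simp add: power_add mult_ac divide_simps power2_eq_square del: of_nat_Suc of_nat_add)
  also have "\<dots> \<longleftrightarrow> summable (\<lambda>k. norm z ^ k / fact (k + 2))"
    by (subst summable_cmult_iff) (use \<open>z \<noteq> 0\<close> in auto)
  finally have summable: "summable (\<lambda>k. norm z ^ k / fact (k + 2))" .
  have "exp z - 1 - z = (\<Sum>k. z ^ (k + 2) / fact (k + 2))"
    using sums by (simp add: sums_iff scaleR_conv_of_real divide_simps eval_nat_numeral)
  also have "norm \<dots> \<le> (\<Sum>k. norm (z ^ (k + 2) / fact (k + 2)))"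
    using summable_norm_exp[of z]
    by (intro summable_norm summable_ignore_initial_segment)
       (auto simp: norm_power norm_divide divide_simps)
  also have "\<dots> = (\<Sum>k. norm z ^ 2 * (norm z ^ k / fact (k + 2)))"
    by (simp add: power_add norm_power norm_divide mult_ac norm_mult power2_eq_square
        del: of_nat_Suc)
  also have "\<dots> = norm z ^ 2 * (\<Sum>k. norm z ^ k / fact (k + 2))"
    using summable by (rule suminf_mult)
  also have "\<dots> \<le> norm z ^ 2 * (1 / (1 - norm z) / 2)"
  proof (intro mult_left_mono, rule sums_le)
    show "(\<lambda>k. norm z ^ k / fact (k + 2)) sums (\<Sum>k. norm z ^ k / fact (k + 2))"
      using summable by blast
    show "(\<lambda>k. norm z ^ k / 2) sums (1 / (1 - norm z) / 2)"
      using assms by (intro geometric_sums sums_divide) auto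
  next
    fix k :: nat
    have "norm z ^ k / fact (k + 2) \<le> norm z ^ k / fact 2"
      by (intro divide_left_mono fact_mono) auto
    then show "norm z ^ k / fact (k + 2) \<le> norm z ^ k / 2"
      by simp
  qed auto
  also have "\<dots> \<le> norm z ^ 2 * 1"
    using assms by (intro mult_left_mono) (auto simp: divide_simps)
  finally show ?thesis by simp
qed auto

lemma exp_weight_remainder:
  assumes s: "s \<in> {-1..0::real}" and h: "cmod h \<le> 1/2"
  shows "cmod (exp ((l + h) * of_real s) - exp (l * of_real s) - h * (of_real s * exp (l * of_real s)))
         \<le> exp (cmod l) * cmod h ^ 2"
proof -
  have hs: "cmod (h * of_real s) \<le> cmod h"
    using s mult_left_mono[of "-s" 1 "cmod h"] by (auto simp: norm_mult)
  have "cmod (exp (h * of_real s) - 1 - h * of_real s) \<le> cmod (h * of_real s) ^ 2"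
    using hs h by (intro exp_quad_bound) linarith
  also have "\<dots> \<le> cmod h ^ 2"
    using hs by (intro power_mono) auto
  finally have "cmod (exp (l * of_real s)) * cmod (exp (h * of_real s) - 1 - h * of_real s)
      \<le> exp (cmod l) * cmod h ^ 2"
    using norm_exp_weight[OF s] by (intro mult_mono) auto
  moreover have "exp ((l + h) * of_real s) - exp (l * of_real s) - h * (of_real s * exp (l * of_real s))
      = exp (l * of_real s) * (exp (h * of_real s) - 1 - h * of_real s)"
    by (simp add: distrib_right exp_add algebra_simps)
  ultimately show ?thesis
    by (simp add: norm_mult)
qed

lemma exp_transform_remainder:
  fixes a :: "real \<Rightarrow> complex"
  assumes a: "set_integrable lborel {-1..0} a" and h: "cmod h \<le> 1/2"
  shows "cmod (exp_transform a (l + h) - exp_transform a l - h * exp_transform (\<lambda>s. of_real s * a s) l)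
         \<le> exp (cmod l) * cmod h ^ 2 * (LINT s:{-1..0}|lborel. norm (a s))"
proof -
  let ?r = "\<lambda>s. exp ((l + h) * of_real s) - exp (l * of_real s) - h * (of_real s * exp (l * of_real s))"
  define f where "f z = (\<lambda>s. exp (z * of_real s) * a s)" for z
  define g where "g = (\<lambda>s. h * (exp (l * of_real s) * (of_real s * a s)))"
  have f: "set_integrable lborel {-1..0} (f z)" for z
    unfolding f_def by (rule set_integrable_exp_weight[OF a])
  have g: "set_integrable lborel {-1..0} g"
    unfolding g_def by (intro set_integrable_mult_right set_integrable_exp_weight
        set_integrable_times_var a)
  have r: "?r s * a s = f (l + h) s - f l s - g s" for s
    by (simp add: f_def g_def algebra_simps)
  have ir: "set_integrable lborel {-1..0} (\<lambda>s. ?r s * a s)"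
    unfolding r by (intro set_integral_diff(1) f g)
  have "exp_transform a (l + h) - exp_transform a l - h * exp_transform (\<lambda>s. of_real s * a s) l
      = (LINT s:{-1..0}|lborel. ?r s * a s)"
    unfolding r set_integral_diff(2)[OF set_integral_diff(1)[OF f f] g] set_integral_diff(2)[OF f f]
    by (simp add: exp_transform_def f_def g_def)
  then have "cmod (exp_transform a (l + h) - exp_transform a l
      - h * exp_transform (\<lambda>s. of_real s * a s) l) = cmod (LINT s:{-1..0}|lborel. ?r s * a s)"
    by (rule arg_cong)
  also have "\<dots> \<le> (LINT s:{-1..0}|lborel. cmod (?r s * a s))"
    by (rule set_integral_norm_bound[OF ir])
  also have "\<dots> \<le> (LINT s:{-1..0}|lborel. exp (cmod l) * cmod h ^ 2 * norm (a s))"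
  proof (rule set_integral_mono)
    show "set_integrable lborel {-1..0} (\<lambda>s. cmod (?r s * a s))"
      by (rule set_integrable_norm[OF ir])
    show "set_integrable lborel {-1..0} (\<lambda>s. exp (cmod l) * cmod h ^ 2 * norm (a s))"
      using set_integrable_norm[OF a] by (rule set_integrable_mult_right)
  next
    fix s :: real assume "s \<in> {-1..0}"
    then show "cmod (?r s * a s) \<le> exp (cmod l) * cmod h ^ 2 * norm (a s)"
      unfolding norm_mult by (intro mult_right_mono exp_weight_remainder h) auto
  qed
  finally show ?thesis
    by simp
qed

lemma exp_transform_has_field_derivative:
  fixes a :: "real \<Rightarrow> complex"
  assumes a: "set_integrable lborel {-1..0} a"
  shows "(exp_transform a has_field_derivative exp_transform (\<lambda>s. of_real s * a s) l) (at l)"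
proof -
  define N where "N = (LINT s:{-1..0}|lborel. norm (a s))"
  let ?F = "exp_transform a" and ?G = "exp_transform (\<lambda>s. of_real s * a s) l"
  have "((\<lambda>y. (?F y - ?F l) / (y - l) - ?G) \<longlongrightarrow> 0) (at l)"
  proof (rule Lim_null_comparison)
    show "\<forall>\<^sub>F y in at l. cmod ((?F y - ?F l) / (y - l) - ?G) \<le> exp (cmod l) * N * cmod (y - l)"
      unfolding eventually_at
    proof (intro exI[of _ "1/2"] conjI ballI impI)
      fix y assume "y \<noteq> l \<and> dist y l < 1/2"
      then have ne: "y - l \<noteq> 0" and d: "cmod (y - l) \<le> 1/2"
        by (auto simp: dist_norm)
      have "cmod ((?F y - ?F l) / (y - l) - ?G) = cmod (?F y - ?F l - (y - l) * ?G) / cmod (y - l)"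
        using ne by (simp add: field_simps norm_divide)
      also have "\<dots> \<le> exp (cmod l) * cmod (y - l)^2 * N / cmod (y - l)"
        using exp_transform_remainder[OF a d, of l] ne unfolding N_def
        by (intro divide_right_mono) auto
      also have "\<dots> = exp (cmod l) * N * cmod (y - l)"
        using ne by (simp add: power2_eq_square)
      finally show "cmod ((?F y - ?F l) / (y - l) - ?G) \<le> exp (cmod l) * N * cmod (y - l)" .
    qed simp
    show "((\<lambda>y. exp (cmod l) * N * cmod (y - l)) \<longlongrightarrow> 0) (at l)"
      by (intro tendsto_eq_intros) auto
  qed
  then show ?thesis
    unfolding has_field_derivative_iff by (simp add: LIM_zero_iff)
qed

lemma mat_functional_exp_integral:
  fixes A :: "real \<Rightarrow> complex^'n^'m"
  assumes L: "mat_functional L" and A: "set_integrable lborel {-1..0} A"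
  shows "L (LINT s:{-1..0}|lborel. msc (exp (l * of_real s)) (A s)) = exp_transform (\<lambda>s. L (A s)) l"
  using integral_msc_bounded_linear[OF mat_functional_bounded_linear[OF L] A] L
  by (simp add: exp_transform_def mat_functional_def)

section \<open>The characteristic matrix\<close>

lemma Delta_functional:
  assumes L: "mat_functional L"
    and A2: "set_integrable lborel {-1..0} A2" and A3: "set_integrable lborel {-1..0} A3"
  shows "L (Delta Am1 A2 A3 l) = - l * L (mat 1) + l * exp (- l) * L Am1
      + l * exp_transform (\<lambda>s. L (A2 s)) l + exp_transform (\<lambda>s. L (A3 s)) l"
  using L unfolding Delta_def
  by (simp add: mat_functional_def mat_functional_exp_integral[OF L A2]
      mat_functional_exp_integral[OF L A3])

lemma Delta_pairing:
  assumes A2: "set_integrable lborel {-1..0} A2" and A3: "set_integrable lborel {-1..0} A3"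
  shows "cip (Delta Am1 A2 A3 l *v x) y = - l * cip x y + l * exp (- l) * cip (Am1 *v x) y
      + l * exp_transform (\<lambda>s. cip (A2 s *v x) y) l + exp_transform (\<lambda>s. cip (A3 s *v x) y) l"
  using Delta_functional[OF mat_functional_pairing A2 A3] by simp

lemma Delta_functional_deriv:
  assumes L: "mat_functional L"
    and A2: "set_integrable lborel {-1..0} A2" and A3: "set_integrable lborel {-1..0} A3"
  shows "((\<lambda>z. L (Delta Am1 A2 A3 z)) has_field_derivative
      - L (mat 1) + (1 - l) * exp (- l) * L Am1 + exp_transform (\<lambda>s. L (A2 s)) l
      + l * exp_transform (\<lambda>s. of_real s * L (A2 s)) l
      + exp_transform (\<lambda>s. of_real s * L (A3 s)) l) (at l)"
proof -
  note bl = mat_functional_bounded_linear[OF L]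
  have a2: "set_integrable lborel {-1..0} (\<lambda>s. L (A2 s))"
    by (rule set_integral_bounded_linear(1)[OF bl A2])
  have a3: "set_integrable lborel {-1..0} (\<lambda>s. L (A3 s))"
    by (rule set_integral_bounded_linear(1)[OF bl A3])
  show ?thesis
    unfolding Delta_functional[OF L A2 A3]
    by (rule derivative_eq_intros exp_transform_has_field_derivative[OF a2]
        exp_transform_has_field_derivative[OF a3] refl | simp)+
       (simp add: algebra_simps)
qed

lemma Delta_deriv_pairing:
  fixes x y :: "complex^'n"
  assumes A2: "set_integrable lborel {-1..0} A2" and A3: "set_integrable lborel {-1..0} A3"
  shows "((\<lambda>z. cip (Delta Am1 A2 A3 z *v x) y) has_field_derivative
      cip (Delta_deriv Am1 A2 A3 l *v x) y) (at l)"
proof -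
  have expand: "cip (M *v x) y = (\<Sum>i\<in>UNIV. \<Sum>j\<in>UNIV. M $ i $ j * (x $ j * cnj (y $ i)))"
    for M :: "complex^'n^'n"
    by (simp add: cip_def matrix_vector_mult_def sum_distrib_left sum_distrib_right mult_ac)
  have "(\<lambda>z. Delta Am1 A2 A3 z $ i $ j) field_differentiable (at l)" for i j
    using Delta_functional_deriv[OF mat_functional_entry A2 A3]
    unfolding field_differentiable_def by blast
  then have "((\<lambda>z. Delta Am1 A2 A3 z $ i $ j) has_field_derivative Delta_deriv Am1 A2 A3 l $ i $ j)
      (at l)" for i j
    by (simp add: Delta_deriv_def DERIV_deriv_iff_field_differentiable)
  then show ?thesis
    unfolding expand by (intro DERIV_sum DERIV_cmult_right)
qed

lemma Delta_star_cnj: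
  assumes A2: "set_integrable lborel {-1..0} A2" and A3: "set_integrable lborel {-1..0} A3"
  shows "Delta_star Am1 A2 A3 (cnj l) = cadj (Delta Am1 A2 A3 l)"
  unfolding Delta_star_def Delta_def
  by (simp add: cadj_add cadj_msc cadj_mat1 exp_cnj
      integral_msc_bounded_linear[OF bounded_linear_cadj A2 order_refl]
      integral_msc_bounded_linear[OF bounded_linear_cadj A3 order_refl])

section \<open>Elementary integrals and Fubini on a triangle\<close>

lemma exp_integral_closed_form:
  fixes \<mu> :: complex and s :: real
  assumes s: "-1 \<le> s"
  shows "(LINT t:{-1..s}|lborel. exp (\<mu> * of_real t))
       = (if \<mu> = 0 then of_real (s + 1) else (exp (\<mu> * of_real s) - exp (- \<mu>)) / \<mu>)"
proof -
  define G where "G z = (if \<mu> = 0 then z else exp (\<mu> * z) / \<mu>)" for z :: complex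
  have "(G has_field_derivative exp (\<mu> * z)) (at z)" for z
    unfolding G_def by (cases "\<mu> = 0") (auto intro!: derivative_eq_intros)
  then have "(LBINT t=ereal (-1)..ereal s. exp (\<mu> * of_real t)) = G (of_real s) - G (of_real (-1))"
    by (intro interval_integral_FTC_finite continuous_intros has_vector_derivative_real_field)
  moreover have "(LBINT t=ereal (-1)..ereal s. exp (\<mu> * of_real t))
      = (LINT t:{-1..s}|lborel. exp (\<mu> * of_real t))"
    by (rule interval_integral_Icc[OF s])
  ultimately show ?thesis
    unfolding G_def by (auto simp: diff_divide_distrib)
qed

lemma kernel_integral_distinct:
  fixes c :: "real \<Rightarrow> complex"
  assumes c: "set_integrable lborel {-1..0} c" and ne: "l0 \<noteq> l1"
  shows "(LINT s:{-1..0}|lborel. exp (l1 * of_real s) * c s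
            * (LINT t:{-1..s}|lborel. exp ((l0 - l1) * of_real t)))
       = (exp_transform c l0 - exp (l1 - l0) * exp_transform c l1) / (l0 - l1)"
proof -
  define \<mu> where "\<mu> = l0 - l1"
  have \<mu>: "\<mu> \<noteq> 0"
    using ne by (simp add: \<mu>_def)
  have "exp (l1 * of_real s) * c s * (LINT t:{-1..s}|lborel. exp (\<mu> * of_real t))
      = (1 / \<mu>) * (exp (l0 * of_real s) * c s) + (- exp (- \<mu>) / \<mu>) * (exp (l1 * of_real s) * c s)"
    if "s \<in> {-1..0}" for s
  proof -
    have E: "(LINT t:{-1..s}|lborel. exp (\<mu> * of_real t)) = (exp (\<mu> * of_real s) - exp (- \<mu>)) / \<mu>"
      using that \<mu> exp_integral_closed_form[of s \<mu>] by simp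
    have "exp (l0 * of_real s) = exp (l1 * of_real s) * exp (\<mu> * of_real s)"
      by (simp add: \<mu>_def algebra_simps flip: exp_add)
    then show ?thesis
      unfolding E using \<mu> by (simp add: field_simps)
  qed
  then have "(LINT s:{-1..0}|lborel. exp (l1 * of_real s) * c s
        * (LINT t:{-1..s}|lborel. exp (\<mu> * of_real t)))
      = (LINT s:{-1..0}|lborel. (1 / \<mu>) * (exp (l0 * of_real s) * c s)
          + (- exp (- \<mu>) / \<mu>) * (exp (l1 * of_real s) * c s))"
    by (intro set_lebesgue_integral_cong) auto
  also have "\<dots> = (exp_transform c l0 - exp (- \<mu>) * exp_transform c l1) / \<mu>"
    unfolding set_integral_add(2)[OF set_integrable_mult_right set_integrable_mult_right,
        OF set_integrable_exp_weight set_integrable_exp_weight, OF c c]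
      set_integral_mult_right exp_transform_def
    by (simp add: diff_divide_distrib)
  finally show ?thesis
    by (simp add: \<mu>_def)
qed

lemma kernel_integral_equal:
  fixes c :: "real \<Rightarrow> complex"
  assumes c: "set_integrable lborel {-1..0} c"
  shows "(LINT s:{-1..0}|lborel. exp (l * of_real s) * c s
            * (LINT t:{-1..s}|lborel. exp ((l - l) * of_real t)))
       = exp_transform (\<lambda>s. of_real s * c s) l + exp_transform c l"
proof -
  have E: "(LINT t:{-1..s}|lborel. 1 :: complex) = of_real s + 1" if "-1 \<le> s" for s
    using exp_integral_closed_form[OF that, of 0] by simp
  have "(LINT s:{-1..0}|lborel. exp (l * of_real s) * c s
        * (LINT t:{-1..s}|lborel. exp ((l - l) * of_real t)))
      = (LINT s:{-1..0}|lborel. exp (l * of_real s) * (of_real s * c s) + exp (l * of_real s) * c s)"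
    by (rule set_lebesgue_integral_cong) (auto simp: E algebra_simps)
  also have "\<dots> = exp_transform (\<lambda>s. of_real s * c s) l + exp_transform c l"
    unfolding exp_transform_def
    by (rule set_integral_add(2)[OF set_integrable_exp_weight set_integrable_exp_weight,
          OF set_integrable_times_var[OF c] c])
  finally show ?thesis .
qed

lemma triangle_kernel_integrable:
  fixes b :: "real \<Rightarrow> complex"
  assumes b: "integrable lborel b"
  shows "integrable (lborel \<Otimes>\<^sub>M lborel) (\<lambda>(t, s). of_real (indicator {-1..0} t)
      * of_real (of_bool (t \<le> s \<and> s \<le> 0)) * exp (\<mu> * of_real t) * b s)"
    (is "integrable _ (\<lambda>(t, s). ?f t s)")
proof -
  have [measurable]: "b \<in> borel_measurable borel"
    using borel_measurable_integrable[OF b] by simp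
  define h where "h t s = indicator {-1..0::real} t * exp (cmod \<mu>) * norm (b s)" for t s
  have h: "integrable (lborel \<Otimes>\<^sub>M lborel) (\<lambda>(t, s). h t s)"
  proof (rule lborel_pair.Fubini_integrable)
    show "(\<lambda>(t, s). h t s) \<in> borel_measurable (lborel \<Otimes>\<^sub>M lborel)"
      unfolding h_def by measurable
    have "(\<lambda>t. \<integral>s. norm (h t s) \<partial>lborel)
        = (\<lambda>t. indicator {-1..0::real} t * (exp (cmod \<mu>) * \<integral>s. norm (b s) \<partial>lborel))"
      unfolding h_def by (auto simp: indicator_def)
    moreover have "integrable lborel
        (\<lambda>t. indicator {-1..0::real} t * (exp (cmod \<mu>) * \<integral>s. norm (b s) \<partial>lborel))"
      by (intro integrable_mult_left integrable_real_indicator) auto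
    ultimately show "integrable lborel (\<lambda>t. \<integral>s. norm (case (t, s) of (t, s) \<Rightarrow> h t s) \<partial>lborel)"
      by simp
    show "AE t in lborel. integrable lborel (\<lambda>s. case (t, s) of (t, s) \<Rightarrow> h t s)"
      unfolding h_def using b by (auto intro!: AE_I2)
  qed
  have "(\<lambda>(t, s). ?f t s) \<in> borel_measurable (lborel \<Otimes>\<^sub>M lborel)"
    by measurable
  then show ?thesis
  proof (rule Bochner_Integration.integrable_bound[OF h], intro AE_I2)
    fix p :: "real \<times> real"
    obtain t s where p: "p = (t, s)" by (cases p)
    show "norm (case p of (t, s) \<Rightarrow> ?f t s) \<le> norm (case p of (t, s) \<Rightarrow> h t s)"
    proof (cases "t \<in> {-1..0}")
      case True
      then show ?thesis
        using norm_exp_weight[OF True, of \<mu>] unfolding p h_def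
        by (auto simp: norm_mult indicator_def intro!: mult_right_mono)
    qed (simp add: p h_def)
  qed
qed

lemma fubini_triangle:
  fixes a :: "real \<Rightarrow> complex" and \<mu> :: complex
  assumes a: "set_integrable lborel {-1..0} a"
  shows "set_integrable lborel {-1..0} (\<lambda>t. exp (\<mu> * of_real t) * (LINT s:{t..0}|lborel. a s))"
    and "(LINT t:{-1..0}|lborel. exp (\<mu> * of_real t) * (LINT s:{t..0}|lborel. a s))
       = (LINT s:{-1..0}|lborel. a s * (LINT t:{-1..s}|lborel. exp (\<mu> * of_real t)))"
proof -
  define b where "b s = of_real (indicator {-1..0::real} s) * a s" for s
  have b: "integrable lborel b"
    using a unfolding set_integrable_def b_def by (simp add: scaleR_conv_of_real)
  define f where "f t s = of_real (indicator {-1..0::real} t) * of_real (of_bool (t \<le> s \<and> s \<le> 0))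
      * exp (\<mu> * of_real t) * b s" for t s
  have f: "integrable (lborel \<Otimes>\<^sub>M lborel) (\<lambda>(t, s). f t s)"
    unfolding f_def by (rule triangle_kernel_integrable[OF b])
  have inner_s: "indicator {-1..0} t *\<^sub>R (exp (\<mu> * of_real t) * (LINT s:{t..0}|lborel. a s))
      = (\<integral>s. f t s \<partial>lborel)" for t
  proof (cases "t \<in> {-1..0}")
    case True
    then have "(\<lambda>s. f t s) = (\<lambda>s. exp (\<mu> * of_real t) * (of_real (indicator {t..0} s) * a s))"
      unfolding f_def b_def by (auto simp: indicator_def)
    then show ?thesis
      using True by (simp add: set_lebesgue_integral_def scaleR_conv_of_real)
  qed (simp add: f_def)
  have inner_t: "indicator {-1..0} s *\<^sub>R (a s * (LINT t:{-1..s}|lborel. exp (\<mu> * of_real t)))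
      = (\<integral>t. f t s \<partial>lborel)" for s
  proof (cases "s \<in> {-1..0}")
    case True
    then have "(\<lambda>t. f t s) = (\<lambda>t. a s * (of_real (indicator {-1..s} t) * exp (\<mu> * of_real t)))"
      unfolding f_def b_def by (auto simp: indicator_def)
    then show ?thesis
      using True by (simp add: set_lebesgue_integral_def scaleR_conv_of_real)
  qed (simp add: f_def b_def)
  show "set_integrable lborel {-1..0} (\<lambda>t. exp (\<mu> * of_real t) * (LINT s:{t..0}|lborel. a s))"
    using lborel_pair.integrable_fst[OF f] unfolding set_integrable_def inner_s by simp
  show "(LINT t:{-1..0}|lborel. exp (\<mu> * of_real t) * (LINT s:{t..0}|lborel. a s))
       = (LINT s:{-1..0}|lborel. a s * (LINT t:{-1..s}|lborel. exp (\<mu> * of_real t)))"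
  proof -
    have "(LINT t:{-1..0}|lborel. exp (\<mu> * of_real t) * (LINT s:{t..0}|lborel. a s))
        = (\<integral>t. \<integral>s. f t s \<partial>lborel \<partial>lborel)"
      using inner_s unfolding set_lebesgue_integral_def by simp
    also have "\<dots> = (\<integral>s. \<integral>t. f t s \<partial>lborel \<partial>lborel)"
      by (rule lborel_pair.Fubini_integral[OF f, symmetric])
    also have "\<dots> = (LINT s:{-1..0}|lborel. a s * (LINT t:{-1..s}|lborel. exp (\<mu> * of_real t)))"
      using inner_t unfolding set_lebesgue_integral_def by simp
    finally show ?thesis .
  qed
qed

lemma interval_integral_reverse_Icc:
  fixes f :: "real \<Rightarrow> 'a::{banach, second_countable_topology}"
  assumes "t \<le> 0"
  shows "(LBINT s=0..t. f s) = - (LINT s:{t..0}|lborel. f s)"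
  using interval_integral_Icc[OF assms, of f] interval_integral_endpoints_reverse[of 0 t f]
  by (simp add: zero_ereal_def)

definition eigvec :: "complex^'n^'n \<Rightarrow> complex \<Rightarrow> complex^'n \<Rightarrow> (complex^'n) \<times> (real \<Rightarrow> complex^'n)"
  where "eigvec Am1 l x = ((mat 1 - msc (exp (-l)) Am1) *v x, \<lambda>t. exp (l * of_real t) *s x)"

definition adj_eigvec :: "(real \<Rightarrow> complex^'n^'n) \<Rightarrow> (real \<Rightarrow> complex^'n^'n) \<Rightarrow> complex \<Rightarrow> complex^'n
    \<Rightarrow> (complex^'n) \<times> (real \<Rightarrow> complex^'n)"
  where "adj_eigvec A2 A3 m y = (y, \<lambda>t. (msc (m * exp (- m * of_real t)) (mat 1) - cadj (A2 t)
                 + msc (exp (- m * of_real t))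
                     (LBINT s=0..t. msc (exp (m * of_real s))
                         (cadj (A3 s) + msc m (cadj (A2 s))))) *v y)"

lemma eigvec_pairing_pointwise:
  assumes A2: "set_integrable lborel {-1..0} A2" and A3: "set_integrable lborel {-1..0} A3"
    and t: "t \<in> {-1..0}"
  shows "cip (snd (eigvec Am1 l0 x) t) (snd (adj_eigvec A2 A3 (cnj l1) y) t)
   = exp (l0 * of_real t) * (l1 * exp (- l1 * of_real t) * cip x y - cip (A2 t *v x) y
       - exp (- l1 * of_real t) * (LINT s:{t..0}|lborel.
            exp (l1 * of_real s) * (cip (A3 s *v x) y + l1 * cip (A2 s *v x) y)))"
proof -
  define K where "K s = cadj (A3 s) + msc (cnj l1) (cadj (A2 s))" for s
  define N where "N s = msc (exp (cnj l1 * of_real s)) (K s)" for s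
  have "set_integrable lborel {-1..0} (\<lambda>s. msc (cnj l1) (cadj (A2 s)))"
    by (rule set_integrable_msc[OF set_integral_bounded_linear(1)[OF bounded_linear_cadj A2],
          where B = "cmod l1"]) auto
  then have "set_integrable lborel {-1..0} K"
    unfolding K_def by (intro set_integral_add(1) set_integral_bounded_linear(1)[OF bounded_linear_cadj A3])
  then have K: "set_integrable lborel {t..0} K"
    by (rule set_integrable_subset) (use t in auto)
  have "cip x ((LINT s:{t..0}|lborel. N s) *v y) = (LINT s:{t..0}|lborel. cip x (N s *v y))"
    unfolding N_def by (rule integral_msc_bounded_linear[OF bounded_linear_pairing_right K])
      (use t in auto)
  also have "\<dots> = (LINT s:{t..0}|lborel.
      exp (l1 * of_real s) * (cip (A3 s *v x) y + l1 * cip (A2 s *v x) y))"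
    by (simp add: N_def K_def matrix_vector_mult_add_rdistrib cip_add_right msc_mult_vec
        cip_scale_right cip_cadj exp_cnj distrib_left mult.assoc)
  finally have integral_part: "cip x ((LINT s:{t..0}|lborel. N s) *v y) = \<dots>" .
  have "cip x ((msc (cnj l1 * exp (- cnj l1 * of_real t)) (mat 1) - cadj (A2 t)
          + msc (exp (- cnj l1 * of_real t)) (LBINT s=0..t. N s)) *v y)
     = l1 * exp (- l1 * of_real t) * cip x y - cip (A2 t *v x) y
       - exp (- l1 * of_real t) * cip x ((LINT s:{t..0}|lborel. N s) *v y)"
    using t
    by (simp add: interval_integral_reverse_Icc matrix_vector_mult_add_rdistrib
        matrix_vector_mult_diff_rdistrib cip_add_right cip_diff_right msc_mult_vec cip_scale_right
        cip_cadj exp_cnj neg_mult_vec)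
  then show ?thesis
    unfolding eigvec_def adj_eigvec_def snd_conv cip_scale_left integral_part
    by (simp add: N_def K_def)
qed

section \<open>The pairing \<open>\<langle>\<phi>, \<psi>\<rangle>\<close> as a scalar expression\<close>

text \<open>Writing \<open>a\<^sub>k(s) = \<langle>A\<^sub>k(s) x, y\<rangle>\<close> and \<open>E(s)\<close> for the integral of \<open>e\<^sup>(\<^sup>\<lambda>\<^sup>0\<^sup>-\<^sup>\<lambda>\<^sup>1\<^sup>)\<^sup>t\<close> over
  \<open>[-1,s]\<close>, the pairing is
  an explicit combination of scalar integrals; the double integral arising from \<open>\<psi>\<close> is
  reduced to a single one by Fubini.\<close>

lemma eigvec_pairing_scalar:
  fixes x y :: "complex^'n" and l0 l1 :: complex
  assumes A2: "set_integrable lborel {-1..0} A2" and A3: "set_integrable lborel {-1..0} A3"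
  defines "a2 \<equiv> \<lambda>s. cip (A2 s *v x) y" and "a3 \<equiv> \<lambda>s. cip (A3 s *v x) y"
    and "E \<equiv> \<lambda>s. LINT t:{-1..s}|lborel. exp ((l0 - l1) * of_real t)"
  shows "M2_inner (eigvec Am1 l0 x) (adj_eigvec A2 A3 (cnj l1) y)
     = cip x y - exp (- l0) * cip (Am1 *v x) y + l1 * cip x y * E 0 - exp_transform a2 l0
       - (LINT s:{-1..0}|lborel. exp (l1 * of_real s) * (a3 s + l1 * a2 s) * E s)"
proof -
  define \<mu> where "\<mu> = l0 - l1"
  define C where "C s = exp (l1 * of_real s) * (a3 s + l1 * a2 s)" for s
  define W where "W t = (LINT s:{t..0}|lborel. C s)" for t
  have a2: "set_integrable lborel {-1..0} a2" and a3: "set_integrable lborel {-1..0} a3"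
    unfolding a2_def a3_def using A2 A3 by (simp_all add: set_integrable_pairing)
  have C: "set_integrable lborel {-1..0} C"
    unfolding C_def using a2 a3
    by (intro set_integrable_exp_weight set_integral_add(1) set_integrable_mult_right)
  have pointwise: "cip (snd (eigvec Am1 l0 x) t) (snd (adj_eigvec A2 A3 (cnj l1) y) t)
      = l1 * cip x y * exp (\<mu> * of_real t) - exp (l0 * of_real t) * a2 t
        - exp (\<mu> * of_real t) * W t" if "t \<in> {-1..0}" for t
  proof -
    have "exp (l0 * of_real t) * exp (- l1 * of_real t) = exp (\<mu> * of_real t)"
      unfolding \<mu>_def exp_add[symmetric] by (simp add: algebra_simps)
    then show ?thesis
      unfolding eigvec_pairing_pointwise[OF A2 A3 that] W_def C_def a2_def a3_def
      by (simp add: algebra_simps)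
  qed
  have e1: "set_integrable lborel {-1..0} (\<lambda>t. l1 * cip x y * exp (\<mu> * of_real t))"
    by (intro set_integrable_mult_right borel_integrable_atLeastAtMost' continuous_intros)
  have e2: "set_integrable lborel {-1..0} (\<lambda>t. exp (l0 * of_real t) * a2 t)"
    by (rule set_integrable_exp_weight[OF a2])
  have e3: "set_integrable lborel {-1..0} (\<lambda>t. exp (\<mu> * of_real t) * W t)"
    unfolding W_def by (rule fubini_triangle(1)[OF C])
  have "(LINT t:{-1..0}|lborel. cip (snd (eigvec Am1 l0 x) t) (snd (adj_eigvec A2 A3 (cnj l1) y) t))
      = (LINT t:{-1..0}|lborel. l1 * cip x y * exp (\<mu> * of_real t) - exp (l0 * of_real t) * a2 t
          - exp (\<mu> * of_real t) * W t)"
    by (rule set_lebesgue_integral_cong) (auto simp: pointwise)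
  also have "\<dots> = l1 * cip x y * E 0 - exp_transform a2 l0 - (LINT s:{-1..0}|lborel. C s * E s)"
    unfolding set_integral_diff(2)[OF set_integral_diff(1)[OF e1 e2] e3] set_integral_diff(2)[OF e1 e2]
    unfolding W_def fubini_triangle(2)[OF C]
    by (simp add: E_def \<mu>_def exp_transform_def)
  finally show ?thesis
    unfolding M2_inner_def
    by (simp add: eigvec_def adj_eigvec_def C_def matrix_vector_mult_diff_rdistrib cip_diff_left
        msc_mult_vec cip_scale_left)
qed

lemma eigvec_pairing_distinct:
  fixes x y :: "complex^'n"
  assumes A2: "set_integrable lborel {-1..0} A2" and A3: "set_integrable lborel {-1..0} A3"
    and ne: "l0 \<noteq> l1"
  shows "(l0 - l1) * M2_inner (eigvec Am1 l0 x) (adj_eigvec A2 A3 (cnj l1) y)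
      = exp (l1 - l0) * cip (Delta Am1 A2 A3 l1 *v x) y - cip (Delta Am1 A2 A3 l0 *v x) y"
proof -
  define a2 where "a2 s = cip (A2 s *v x) y" for s
  define a3 where "a3 s = cip (A3 s *v x) y" for s
  define c where "c s = a3 s + l1 * a2 s" for s
  have a2: "set_integrable lborel {-1..0} a2" and a3: "set_integrable lborel {-1..0} a3"
    unfolding a2_def a3_def using A2 A3 by (simp_all add: set_integrable_pairing)
  have c: "set_integrable lborel {-1..0} c"
    unfolding c_def using a2 a3 by (intro set_integral_add(1) set_integrable_mult_right)
  have transform_c: "exp_transform c l = exp_transform a3 l + l1 * exp_transform a2 l" for l
    unfolding c_def exp_transform_add[OF a3 set_integrable_mult_right[OF a2]] exp_transform_mult ..
  define \<mu> where "\<mu> = l0 - l1"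
  have \<mu>: "\<mu> \<noteq> 0" and l0: "l0 = l1 + \<mu>"
    using ne by (simp_all add: \<mu>_def)
  have E0: "(LINT t:{-1..0}|lborel. exp (\<mu> * of_real t)) = (1 - exp (- \<mu>)) / \<mu>"
    using exp_integral_closed_form[of 0 \<mu>] \<mu> by simp
  have e0: "exp (- l0) = exp (- \<mu>) * exp (- l1)" and e1: "exp (l1 - l0) = exp (- \<mu>)"
    by (simp_all add: \<mu>_def flip: exp_add)
  show ?thesis
    unfolding eigvec_pairing_scalar[OF A2 A3] Delta_pairing[OF A2 A3]
    unfolding a2_def[symmetric] a3_def[symmetric] c_def[symmetric] kernel_integral_distinct[OF c ne]
    unfolding \<mu>_def[symmetric] transform_c E0 e0 e1
    using \<mu> by (simp add: l0 field_simps)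
qed

lemma eigvec_pairing_equal:
  fixes x y :: "complex^'n"
  assumes A2: "set_integrable lborel {-1..0} A2" and A3: "set_integrable lborel {-1..0} A3"
  shows "M2_inner (eigvec Am1 l x) (adj_eigvec A2 A3 (cnj l) y)
      = - cip (Delta Am1 A2 A3 l *v x) y - cip (Delta_deriv Am1 A2 A3 l *v x) y"
proof -
  define a2 where "a2 s = cip (A2 s *v x) y" for s
  define a3 where "a3 s = cip (A3 s *v x) y" for s
  define c where "c s = a3 s + l * a2 s" for s
  have a2: "set_integrable lborel {-1..0} a2" and a3: "set_integrable lborel {-1..0} a3"
    unfolding a2_def a3_def using A2 A3 by (simp_all add: set_integrable_pairing)
  have c: "set_integrable lborel {-1..0} c"
    unfolding c_def using a2 a3 by (intro set_integral_add(1) set_integrable_mult_right)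
  have transform_c: "exp_transform c l = exp_transform a3 l + l * exp_transform a2 l"
    unfolding c_def exp_transform_add[OF a3 set_integrable_mult_right[OF a2]] exp_transform_mult ..
  have "exp_transform (\<lambda>s. of_real s * c s) l
      = exp_transform (\<lambda>s. of_real s * a3 s) l + l * exp_transform (\<lambda>s. of_real s * a2 s) l"
    using exp_transform_add[OF set_integrable_times_var[OF a3]
        set_integrable_mult_right[OF set_integrable_times_var[OF a2]], of l l]
    by (simp add: c_def distrib_left mult.left_commute exp_transform_mult)
  moreover have "cip (Delta_deriv Am1 A2 A3 l *v x) y = - cip x y + (1 - l) * exp (- l) * cip (Am1 *v x) y
      + exp_transform a2 l + l * exp_transform (\<lambda>s. of_real s * a2 s) l
      + exp_transform (\<lambda>s. of_real s * a3 s) l"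
    using DERIV_unique[OF Delta_deriv_pairing[OF A2 A3]
        Delta_functional_deriv[OF mat_functional_pairing A2 A3]]
    by (simp add: a2_def[abs_def] a3_def[abs_def])
  ultimately show ?thesis
    unfolding eigvec_pairing_scalar[OF A2 A3] Delta_pairing[OF A2 A3]
    unfolding a2_def[symmetric] a3_def[symmetric] c_def[symmetric]
    unfolding kernel_integral_equal[OF c] transform_c
    using exp_integral_closed_form[of 0 0] by (simp add: algebra_simps)
qed

theorem lemma1:
  fixes Am1 :: "complex^'n^'n" and A2 A3 :: "real \<Rightarrow> complex^'n^'n"
    and l0 l1 :: complex and x y :: "complex^'n"
    and phi psi :: "(complex^'n) \<times> (real \<Rightarrow> complex^'n)"
  assumes "L2mat A2" and "L2mat A3"
    and "det (Delta Am1 A2 A3 l0) = 0" and "det (Delta Am1 A2 A3 l1) = 0"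
    and "Delta Am1 A2 A3 l0 *v x = 0"
    and "Delta_star Am1 A2 A3 (cnj l1) *v y = 0"
    and "phi = ((mat 1 - msc (exp (-l0)) Am1) *v x, \<lambda>t. exp (l0 * of_real t) *s x)"
    and "psi = (y, \<lambda>t. (msc (cnj l1 * exp (- cnj l1 * of_real t)) (mat 1) - cadj (A2 t)
                 + msc (exp (- cnj l1 * of_real t))
                     (LBINT s=0..t. msc (exp (cnj l1 * of_real s))
                         (cadj (A3 s) + msc (cnj l1) (cadj (A2 s))))) *v y)"
  shows "(l0 \<noteq> l1 \<longrightarrow> M2_inner phi psi = 0) \<and>
         (l0 = l1 \<longrightarrow> M2_inner phi psi = - cip (Delta_deriv Am1 A2 A3 l0 *v x) y)"
proof -
  have A2: "set_integrable lborel {-1..0} A2" and A3: "set_integrable lborel {-1..0} A3"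
    using assms(1,2) by (simp_all add: L2mat_set_integrable)
  have phi: "phi = eigvec Am1 l0 x" and psi: "psi = adj_eigvec A2 A3 (cnj l1) y"
    using assms(7,8) by (simp_all add: eigvec_def adj_eigvec_def)
  have delta0: "cip (Delta Am1 A2 A3 l0 *v x) y = 0"
    using assms(5) by (simp add: cip_def)
  have "cip x (cadj (Delta Am1 A2 A3 l1) *v y) = 0"
    using assms(6) by (simp add: Delta_star_cnj[OF A2 A3, symmetric] cip_def)
  then have delta1: "cip (Delta Am1 A2 A3 l1 *v x) y = 0"
    by (simp add: cip_cadj)
  show ?thesis
  proof (intro conjI impI)
    assume ne: "l0 \<noteq> l1"
    then have "(l0 - l1) * M2_inner phi psi = 0"
      using eigvec_pairing_distinct[OF A2 A3 ne] delta0 delta1 by (simp add: phi psi)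
    then show "M2_inner phi psi = 0"
      using ne by simp
  next
    assume "l0 = l1"
    then show "M2_inner phi psi = - cip (Delta_deriv Am1 A2 A3 l0 *v x) y"
      using eigvec_pairing_equal[OF A2 A3] delta0 by (simp add: phi psi)
  qed
qed

end
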